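(* Consider the problems $\max\{f(S) : |S| = p/q \cdot n\}$ and $\max\{f(S) : |S| \leq p/q \cdot n\}$, where $p < q$ are positive constant integers and $f\colon 2^\mathcal{N} \to \mathbb{R}^+$ is a non-negative symmetric submodular function with $n = |\mathcal{N}|$ obeying $n/q \in \mathbb{Z}$. Then, for any constant $\varepsilon > 0$, every algorithm achieving an approximation ratio of $1/2 + \varepsilon$ for either of these two problems must use an exponential number of value oracle queries.
   Context: A set function $f\colon 2^\mathcal{N} \to \mathbb{R}^+$ is symmetric if $f(S) = f(\mathcal{N}\setminus S)$ for every $S \subseteq \mathcal{N}$, and submodular if $f(A)+f(B) \geq f(A\cup B)+f(A\cap B)$ for all $A,B \subseteq \mathcal{N}$. The function $f$ is accessed only through a value oracle, which given a set $S \subseteq \mathcal{N}$ returns $f(S)$. *)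

theory Defs
  imports "HOL-Probability.Probability"
begin

definition nonneg_on :: "'a set \<Rightarrow> ('a set \<Rightarrow> real) \<Rightarrow> bool" where
  "nonneg_on N f \<longleftrightarrow> (\<forall>S\<subseteq>N. 0 \<le> f S)"

definition symmetric_on :: "'a set \<Rightarrow> ('a set \<Rightarrow> real) \<Rightarrow> bool" where
  "symmetric_on N f \<longleftrightarrow> (\<forall>S\<subseteq>N. f S = f (N - S))"

definition submodular_on :: "'a set \<Rightarrow> ('a set \<Rightarrow> real) \<Rightarrow> bool" where
  "submodular_on N f \<longleftrightarrow> (\<forall>A\<subseteq>N. \<forall>B\<subseteq>N. f A + f B \<ge> f (A \<union> B) + f (A \<inter> B))"

definition sym_submod :: "'a set \<Rightarrow> ('a set \<Rightarrow> real) \<Rightarrow> bool" where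
  "sym_submod N f \<longleftrightarrow> nonneg_on N f \<and> symmetric_on N f \<and> submodular_on N f"

definition card_eq_family :: "nat \<Rightarrow> nat \<Rightarrow> 'a set \<Rightarrow> 'a set set" where
  "card_eq_family p q N = {S. S \<subseteq> N \<and> real (card S) = real p / real q * real (card N)}"

definition card_le_family :: "nat \<Rightarrow> nat \<Rightarrow> 'a set \<Rightarrow> 'a set set" where
  "card_le_family p q N = {S. S \<subseteq> N \<and> real (card S) \<le> real p / real q * real (card N)}"

text \<open>A deterministic value oracle algorithm is an adaptive query strategy: it either stops with
  an output set, or queries a set and continues depending on the oracle's answer. No bound is put
  on the computation done between queries.\<close>

datatype 'a strategy =
    Output "'a set"
  | Query "'a set" "real \<Rightarrow> 'a strategy"

primrec queries :: "('a set \<Rightarrow> real) \<Rightarrow> 'a strategy \<Rightarrow> 'a set list" where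
  "queries f (Output S) = []"
| "queries f (Query S k) = S # queries f (k (f S))"

primrec result :: "('a set \<Rightarrow> real) \<Rightarrow> 'a strategy \<Rightarrow> 'a set" where
  "result f (Output S) = S"
| "result f (Query S k) = result f (k (f S))"

text \<open>A (possibly randomized) algorithm draws a seed from a probability space M and then follows
  the strategy selected by the seed; deterministic algorithms are the constant families. Only
  subsets of the ground set may be submitted to the oracle, and since an algorithm sees f only
  through its answers, values of f outside the subsets of N play no role.\<close>

definition oracle_algorithm ::
  "'a set \<Rightarrow> 'w measure \<Rightarrow> ('w \<Rightarrow> 'a strategy) \<Rightarrow> bool" where
  "oracle_algorithm N M A \<longleftrightarrow> prob_space M \<and>
     (\<forall>f. sym_submod N f \<longrightarrow>
        (\<lambda>\<omega>. queries f (A \<omega>)) \<in> M \<rightarrow>\<^sub>M count_space UNIV \<and>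
        (\<lambda>\<omega>. result f (A \<omega>)) \<in> M \<rightarrow>\<^sub>M count_space UNIV \<and>
        (\<forall>\<omega>\<in>space M. set (queries f (A \<omega>)) \<subseteq> Pow N))"

definition achieves_ratio ::
  "real \<Rightarrow> 'a set \<Rightarrow> 'a set set \<Rightarrow> 'w measure \<Rightarrow> ('w \<Rightarrow> 'a strategy) \<Rightarrow> bool" where
  "achieves_ratio \<alpha> N \<F> M A \<longleftrightarrow>
     (\<forall>f. sym_submod N f \<longrightarrow>
        (AE \<omega> in M. result f (A \<omega>) \<in> \<F>) \<and>
        (\<integral>\<omega>. f (result f (A \<omega>)) \<partial>M) \<ge> \<alpha> * Max (f ` \<F>))"

text \<open>The expectation is at most the worst-case number of queries over all seeds (and equals the
  number of queries of a deterministic algorithm), so lower bounds on it also bound the latter.\<close>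

definition expected_queries ::
  "'w measure \<Rightarrow> ('w \<Rightarrow> 'a strategy) \<Rightarrow> ('a set \<Rightarrow> real) \<Rightarrow> ennreal" where
  "expected_queries M A f = (\<integral>\<^sup>+\<omega>. of_nat (length (queries f (A \<omega>))) \<partial>M)"

end

theory Submission
  imports Defs "HOL-Real_Asymp.Real_Asymp"
begin

text \<open>
  On a set \<open>U\<close> of even size \<open>u\<close>, with \<open>H\<close> a half of \<open>U\<close>, put \<open>m = |S \<inter> U|\<close> and
  \<open>d = |S \<inter> H| - |S \<inter> (U - H)|\<close>. The clique on \<open>U\<close> has cut function \<open>m (u - m)\<close>, and
  \<open>m (u - m) + d\<^sup>2\<close> is twice the cut function of the complete bipartite graph between \<open>H\<close> and
  \<open>U - H\<close>: for increments \<open>m, m'\<close> and \<open>d, d'\<close> the second difference \<open>2 d d'\<close> of the square is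
  compensated by that of the clique cut, \<open>- 2 m m'\<close>, as \<open>|d| \<le> m\<close> and \<open>|d'| \<le> m'\<close>. Replacing \<open>d\<^sup>2\<close>
  by \<open>(max 0 (|d| - \<delta> u / 2))\<^sup>2\<close>, whose derivative is 2-Lipschitz as well, keeps the function
  symmetric and submodular, but makes it agree with the clique cut on every set that \<open>H\<close> splits
  almost evenly. By Hoeffding's inequality a fixed set is split unevenly by an exponentially small
  fraction of the halves. An algorithm run on the clique cut with fewer than exponentially many
  queries therefore has the same run, with high probability, on the function hiding a suitable \<open>H\<close>.
  Its output has value at most \<open>(u / 2)\<^sup>2\<close>, whereas a feasible set meeting \<open>U\<close> exactly in \<open>H\<close> has
  value close to \<open>2 (u / 2)\<^sup>2\<close>.
\<close>

subsection \<open>The square with a dead zone\<close>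

lemma second_difference_le_of_lipschitz_deriv:
  fixes \<phi> \<phi>' :: "real \<Rightarrow> real"
  assumes deriv: "\<And>x. (\<phi> has_real_derivative \<phi>' x) (at x)"
    and lipschitz: "L-lipschitz_on UNIV \<phi>'"
  shows "\<bar>\<phi> (x + a + b) - \<phi> (x + a) - \<phi> (x + b) + \<phi> x\<bar> \<le> L * \<bar>a\<bar> * \<bar>b\<bar>"
proof -
  define \<psi> where "\<psi> t = \<phi> (t + b) - \<phi> t" for t
  have "(\<psi> has_real_derivative \<phi>' (t + b) - \<phi>' t) (at t)" for t
    unfolding \<psi>_def by (auto intro!: derivative_intros DERIV_shift[THEN iffD1] deriv)
  moreover have "\<bar>\<phi>' (t + b) - \<phi>' t\<bar> \<le> L * \<bar>b\<bar>" for t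
    using lipschitz_on_normD[OF lipschitz, of "t + b" t] by simp
  ultimately have "\<bar>\<psi> (x + a) - \<psi> x\<bar> \<le> L * \<bar>b\<bar> * \<bar>a\<bar>"
    using field_differentiable_bound[of UNIV \<psi> "\<lambda>t. \<phi>' (t + b) - \<phi>' t" "L * \<bar>b\<bar>" "x + a" x]
    by simp
  then show ?thesis by (simp add: \<psi>_def mult.commute mult.left_commute algebra_simps)
qed

lemma has_real_derivative_pos_part_square:
  "((\<lambda>x. (max 0 x)\<^sup>2) has_real_derivative 2 * max 0 x) (at (x :: real))"
proof -
  consider (neg) "x < 0" | (zero) "x = 0" | (pos) "0 < x" by linarith
  then show ?thesis
  proof cases
    case neg
    have "((\<lambda>x. 0) has_real_derivative 2 * max 0 x) (at x)" using neg by simp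
    then show ?thesis
      by (rule has_field_derivative_transform_within_open[of _ _ _ "{..<0}"]) (use neg in auto)
  next
    case zero
    have "isCont (max 0) (0 :: real)" by (intro continuous_intros)
    then show ?thesis
      unfolding CARAT_DERIV using zero
      by (intro exI[of _ "max 0"]) (auto simp: max_def power2_eq_square)
  next
    case pos
    have "((\<lambda>x. x\<^sup>2) has_real_derivative 2 * max 0 x) (at x)"
      using pos by (auto intro!: derivative_eq_intros)
    then show ?thesis
      by (rule has_field_derivative_transform_within_open[of _ _ _ "{0<..}"]) (use pos in auto)
  qed
qed

definition dead_zone_sq :: "real \<Rightarrow> real \<Rightarrow> real" where
  "dead_zone_sq D x = (max 0 (\<bar>x\<bar> - D))\<^sup>2"

lemma dead_zone_sq_nonneg: "0 \<le> dead_zone_sq D x"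
  by (simp add: dead_zone_sq_def)

lemma dead_zone_sq_minus: "dead_zone_sq D (- x) = dead_zone_sq D x"
  by (simp add: dead_zone_sq_def)

lemma dead_zone_sq_eq_0: "\<bar>x\<bar> \<le> D \<Longrightarrow> dead_zone_sq D x = 0"
  by (simp add: dead_zone_sq_def)

lemma dead_zone_sq_le: "0 \<le> D \<Longrightarrow> dead_zone_sq D x \<le> x\<^sup>2"
  by (auto simp: dead_zone_sq_def abs_le_square_iff[symmetric])

lemma has_real_derivative_dead_zone_sq:
  assumes "0 \<le> D"
  shows "(dead_zone_sq D has_real_derivative 2 * (max 0 (x - D) - max 0 (- x - D))) (at x)"
proof -
  note pos_part = DERIV_chain2[OF has_real_derivative_pos_part_square]
  have "((\<lambda>x. (max 0 (x - D))\<^sup>2 + (max 0 (- x - D))\<^sup>2) has_real_derivative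
      2 * max 0 (x - D) * 1 + 2 * max 0 (- x - D) * (- 1)) (at x)"
    by (intro DERIV_add pos_part) (auto intro!: derivative_eq_intros)
  moreover have "dead_zone_sq D = (\<lambda>x. (max 0 (x - D))\<^sup>2 + (max 0 (- x - D))\<^sup>2)"
    using assms by (auto simp: dead_zone_sq_def max_def abs_if)
  ultimately show ?thesis by simp
qed

lemma dead_zone_sq_second_difference_le:
  assumes "0 \<le> D"
  shows "dead_zone_sq D (x + a + b) + dead_zone_sq D x
       \<le> dead_zone_sq D (x + a) + dead_zone_sq D (x + b) + 2 * \<bar>a\<bar> * \<bar>b\<bar>"
proof -
  have "2-lipschitz_on UNIV (\<lambda>x. 2 * (max 0 (x - D) - max 0 (- x - D)))"
    using assms by (intro lipschitz_onI) (auto simp: dist_real_def max_def abs_if)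
  from second_difference_le_of_lipschitz_deriv
      [OF has_real_derivative_dead_zone_sq[OF assms] this, of x a b]
  show ?thesis by linarith
qed

subsection \<open>Hiding a half of a clique\<close>

definition clique_cut :: "'a set \<Rightarrow> 'a set \<Rightarrow> real" where
  "clique_cut U S = real (card (S \<inter> U)) * real (card (U - S))"

definition imbalance :: "'a set \<Rightarrow> 'a set \<Rightarrow> 'a set \<Rightarrow> real" where
  "imbalance U H S = real (card (S \<inter> H)) - real (card (S \<inter> (U - H)))"

definition hidden_cut :: "'a set \<Rightarrow> 'a set \<Rightarrow> real \<Rightarrow> 'a set \<Rightarrow> real" where
  "hidden_cut U H \<delta> S = clique_cut U S + dead_zone_sq (\<delta> * (card U / 2)) (imbalance U H S)"

definition halves :: "'a set \<Rightarrow> 'a set set" where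
  "halves U = {H. H \<subseteq> U \<and> card U = 2 * card H}"

lemma finite_halves: "finite U \<Longrightarrow> finite (halves U)"
  by (simp add: halves_def)

lemma clique_cut_eq:
  assumes "finite U"
  shows "clique_cut U S = real (card (S \<inter> U)) * (real (card U) - real (card (S \<inter> U)))"
  using card_Int_Diff[OF assms, of S] by (simp add: clique_cut_def Int_commute)

lemma clique_cut_le: "finite U \<Longrightarrow> clique_cut U S \<le> (real (card U) / 2)\<^sup>2"
  using mult_const_minus_self_real_le by (simp add: clique_cut_eq power_divide)

lemma clique_cut_nonneg: "0 \<le> clique_cut U S"
  by (simp add: clique_cut_def)

lemma clique_cut_Diff:
  assumes "U \<subseteq> N"
  shows "clique_cut U (N - S) = clique_cut U S"
proof -
  have "(N - S) \<inter> U = U - S" "U - (N - S) = S \<inter> U" using assms by auto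
  then show ?thesis by (simp add: clique_cut_def)
qed

lemma card_Un_disjoint_Int:
  assumes "finite V" "A \<inter> B = {}"
  shows "card ((A \<union> B) \<inter> V) = card (A \<inter> V) + card (B \<inter> V)"
  using assms by (subst card_Un_disjoint[symmetric]) (auto simp: Int_Un_distrib2)

lemma imbalance_Un_disjoint:
  assumes "finite U" "H \<subseteq> U" "A \<inter> B = {}"
  shows "imbalance U H (A \<union> B) = imbalance U H A + imbalance U H B"
  using assms finite_subset[OF assms(2,1)] by (simp add: imbalance_def card_Un_disjoint_Int)

lemma imbalance_eq:
  assumes "finite U" "H \<subseteq> U"
  shows "imbalance U H S = 2 * real (card (S \<inter> H)) - real (card (S \<inter> U))"
proof -
  have "S \<inter> U \<inter> H = S \<inter> H" "S \<inter> U - H = S \<inter> (U - H)" using assms by auto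
  then show ?thesis
    using card_Int_Diff[of "S \<inter> U" H] assms by (simp add: imbalance_def)
qed

lemma abs_imbalance_le:
  assumes "finite U" "H \<subseteq> U"
  shows "\<bar>imbalance U H S\<bar> \<le> real (card (S \<inter> U))"
proof -
  have "card (S \<inter> H) \<le> card (S \<inter> U)" using assms by (intro card_mono) auto
  then show ?thesis by (simp add: imbalance_eq[OF assms])
qed

lemma halvesD:
  assumes "finite U" "H \<in> halves U"
  shows "H \<subseteq> U" "finite H" "card U = 2 * card H" "card (U - H) = card H"
  using assms finite_subset[of H U] by (auto simp: halves_def card_Diff_subset)

lemma abs_imbalance_half_le:
  assumes "finite U" "H \<in> halves U"
  shows "\<bar>imbalance U H S\<bar> \<le> real (card U) / 2"
proof -
  have "card (S \<inter> H) \<le> card H" "card (S \<inter> (U - H)) \<le> card (U - H)"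
    using assms(1) halvesD(2)[OF assms] by (auto intro: card_mono)
  then show ?thesis using halvesD[OF assms] by (simp add: imbalance_def)
qed

lemma imbalance_half_Diff:
  assumes "finite U" "U \<subseteq> N" "H \<in> halves U"
  shows "imbalance U H (N - S) = - imbalance U H S"
proof -
  have compl: "real (card ((N - S) \<inter> V)) = real (card V) - real (card (S \<inter> V))"
    if "finite V" "V \<subseteq> N" for V
  proof -
    have "(N - S) \<inter> V = V - S" using that by auto
    then show ?thesis using card_Int_Diff[OF that(1), of S] by (simp add: Int_commute)
  qed
  have "H \<subseteq> N" "U - H \<subseteq> N" using assms halvesD(1)[OF assms(1,3)] by auto
  then show ?thesis
    using assms halvesD[OF assms(1,3)] by (simp add: imbalance_def compl)
qed

lemma submodular_onI_disjoint:
  fixes F :: "'a set \<Rightarrow> real"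
  assumes "\<And>I A B. I \<inter> A = {} \<Longrightarrow> I \<inter> B = {} \<Longrightarrow> A \<inter> B = {} \<Longrightarrow> I \<union> A \<union> B \<subseteq> N \<Longrightarrow>
      F (I \<union> A \<union> B) + F I \<le> F (I \<union> A) + F (I \<union> B)"
  shows "submodular_on N F"
  unfolding submodular_on_def
proof (intro allI impI)
  fix X Y assume "X \<subseteq> N" "Y \<subseteq> N"
  then have "F (X \<inter> Y \<union> (X - Y) \<union> (Y - X)) + F (X \<inter> Y)
      \<le> F (X \<inter> Y \<union> (X - Y)) + F (X \<inter> Y \<union> (Y - X))"
    by (intro assms) auto
  moreover have "X \<inter> Y \<union> (X - Y) = X" "X \<inter> Y \<union> (Y - X) = Y" "X \<union> (Y - X) = X \<union> Y" by auto
  ultimately show "F (X \<union> Y) + F (X \<inter> Y) \<le> F X + F Y" by simp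
qed

lemma submodular_on_clique_cut_plus:
  assumes "finite U" "H \<subseteq> U"
    and second_diff: "\<And>x a b.
      \<phi> (x + a + b) + \<phi> x \<le> \<phi> (x + a) + \<phi> (x + b) + 2 * \<bar>a\<bar> * \<bar>b\<bar>"
  shows "submodular_on N (\<lambda>S. clique_cut U S + \<phi> (imbalance U H S))"
proof (rule submodular_onI_disjoint)
  fix I A B :: "'a set"
  assume "I \<inter> A = {}" "I \<inter> B = {}" "A \<inter> B = {}"
  then have disj: "I \<inter> A = {}" "I \<inter> B = {}" "(I \<union> A) \<inter> B = {}" by auto
  have "clique_cut U (I \<union> A \<union> B) + clique_cut U I + 2 * (real (card (A \<inter> U)) * real (card (B \<inter> U)))
      = clique_cut U (I \<union> A) + clique_cut U (I \<union> B)"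
    using assms(1) disj by (simp add: clique_cut_eq card_Un_disjoint_Int algebra_simps)
  moreover have "\<bar>imbalance U H A\<bar> * \<bar>imbalance U H B\<bar> \<le> real (card (A \<inter> U)) * real (card (B \<inter> U))"
    using assms abs_imbalance_le by (intro mult_mono) auto
  moreover have "\<phi> (imbalance U H (I \<union> A \<union> B)) + \<phi> (imbalance U H I)
      \<le> \<phi> (imbalance U H (I \<union> A)) + \<phi> (imbalance U H (I \<union> B))
        + 2 * (\<bar>imbalance U H A\<bar> * \<bar>imbalance U H B\<bar>)"
    using assms(1,2) disj second_diff[of "imbalance U H I" "imbalance U H A" "imbalance U H B"]
    by (simp add: imbalance_Un_disjoint mult.assoc)
  ultimately show "clique_cut U (I \<union> A \<union> B) + \<phi> (imbalance U H (I \<union> A \<union> B))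
        + (clique_cut U I + \<phi> (imbalance U H I))
      \<le> clique_cut U (I \<union> A) + \<phi> (imbalance U H (I \<union> A))
        + (clique_cut U (I \<union> B) + \<phi> (imbalance U H (I \<union> B)))"
    by linarith
qed

lemma sym_submod_clique_cut:
  assumes "finite U" "U \<subseteq> N"
  shows "sym_submod N (clique_cut U)"
  using assms submodular_on_clique_cut_plus[OF assms(1) subset_refl, of "\<lambda>_. 0" N]
  by (simp add: sym_submod_def nonneg_on_def symmetric_on_def clique_cut_nonneg clique_cut_Diff)

lemma sym_submod_hidden_cut:
  assumes "finite U" "U \<subseteq> N" "H \<in> halves U" "0 \<le> \<delta>"
  shows "sym_submod N (hidden_cut U H \<delta>)"
  unfolding sym_submod_def
proof (intro conjI)
  have threshold_nonneg: "0 \<le> \<delta> * (card U / 2)" using assms(4) by simp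
  show "nonneg_on N (hidden_cut U H \<delta>)"
    by (simp add: nonneg_on_def hidden_cut_def clique_cut_nonneg dead_zone_sq_nonneg)
  show "symmetric_on N (hidden_cut U H \<delta>)"
    using assms
    by (simp add: symmetric_on_def hidden_cut_def clique_cut_Diff imbalance_half_Diff
        dead_zone_sq_minus)
  show "submodular_on N (hidden_cut U H \<delta>)"
    using submodular_on_clique_cut_plus[OF assms(1) halvesD(1)[OF assms(1,3)]
        dead_zone_sq_second_difference_le[OF threshold_nonneg]]
    by (simp add: hidden_cut_def[abs_def])
qed

lemma hidden_cut_eq_clique_cut:
  "\<bar>imbalance U H S\<bar> \<le> \<delta> * (card U / 2) \<Longrightarrow> hidden_cut U H \<delta> S = clique_cut U S"
  by (simp add: hidden_cut_def dead_zone_sq_eq_0)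

lemma hidden_cut_le:
  assumes "finite U" "H \<in> halves U" "0 \<le> \<delta>"
  shows "hidden_cut U H \<delta> S \<le> 2 * (real (card U) / 2)\<^sup>2"
proof -
  have "dead_zone_sq (\<delta> * (card U / 2)) (imbalance U H S) \<le> (imbalance U H S)\<^sup>2"
    using assms(3) by (intro dead_zone_sq_le) simp
  also have "\<dots> \<le> (real (card U) / 2)\<^sup>2"
    using abs_imbalance_half_le[OF assms(1,2)] by (intro abs_le_square_iff[THEN iffD1]) simp
  finally show ?thesis
    using clique_cut_le[OF assms(1), of S] by (simp add: hidden_cut_def)
qed

lemma hidden_cut_at_half:
  assumes "finite U" "S \<inter> U \<in> halves U" "\<delta> \<le> 1"
  shows "hidden_cut U (S \<inter> U) \<delta> S = (1 + (1 - \<delta>)\<^sup>2) * (real (card U) / 2)\<^sup>2"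
proof -
  let ?H = "S \<inter> U"
  have cards: "real (card ?H) = card U / 2" "real (card (U - ?H)) = card U / 2"
    using halvesD[OF assms(1,2)] by auto
  have sets: "S \<inter> ?H = ?H" "S \<inter> (U - ?H) = {}" "U - S = U - ?H" by auto
  have "clique_cut U S = (card U / 2)\<^sup>2"
    by (simp only: clique_cut_def cards sets power2_eq_square)
  moreover have "imbalance U ?H S = card U / 2"
    by (simp only: imbalance_def cards sets) simp
  moreover have "dead_zone_sq (\<delta> * (card U / 2)) (card U / 2) = ((1 - \<delta>) * (card U / 2))\<^sup>2"
  proof -
    have "\<delta> * (card U / 2) \<le> 1 * (card U / 2)" using assms(3) by (intro mult_right_mono) auto
    then show ?thesis by (simp add: dead_zone_sq_def left_diff_distrib)
  qed
  ultimately show ?thesis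
    by (simp only: hidden_cut_def power_mult_distrib distrib_right mult_1)
qed

subsection \<open>Random subsets are balanced\<close>

lemma map_pmf_card_Int_Pow:
  assumes "finite U" "T \<subseteq> U"
  shows "map_pmf (\<lambda>A. card (T \<inter> A)) (pmf_of_set (Pow U)) = binomial_pmf (card T) (1 / 2)"
proof -
  let ?coins = "\<lambda>V. Pi_pmf V False (\<lambda>_. bernoulli_pmf (1 / 2))"
  have "finite T" using assms finite_subset by auto
  then have "binomial_pmf (card T) (1 / 2) = map_pmf (\<lambda>b. card {x \<in> T. b x}) (?coins T)"
    by (intro binomial_pmf_altdef') auto
  also have "?coins T = map_pmf (\<lambda>b x. if x \<in> T then b x else False) (?coins U)"
    by (rule Pi_pmf_subset[OF assms])
  also have "map_pmf (\<lambda>b. card {x \<in> T. b x}) \<dots>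
      = map_pmf (\<lambda>b. card (T \<inter> {x \<in> U. b x})) (?coins U)"
    unfolding pmf.map_comp comp_def
    using assms by (intro map_pmf_cong refl arg_cong[of _ _ card]) auto
  also have "\<dots> = map_pmf (\<lambda>A. card (T \<inter> A)) (pmf_of_set (Pow U))"
    by (simp add: pmf_of_set_Pow_conv_bernoulli[OF assms(1), of False, symmetric]
        pmf.map_comp comp_def)
  finally show ?thesis ..
qed

lemma card_imbalanced_subsets_le:
  assumes "finite U" "0 < t"
  shows "real (card {A \<in> Pow U. t \<le> \<bar>imbalance U A S\<bar>})
       \<le> 2 * exp (- t\<^sup>2 / (2 * card U)) * 2 ^ card U"
proof (cases "S \<inter> U = {}")
  case True
  then have none: "{A \<in> Pow U. t \<le> \<bar>imbalance U A S\<bar>} = {}"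
    using abs_imbalance_le[OF assms(1), of _ S] assms(2) by force
  show ?thesis unfolding none by simp
next
  case False
  define m where "m = card (S \<inter> U)"
  have m: "0 < m" "m \<le> card U"
    using assms False by (auto simp: m_def card_gt_0_iff intro: card_mono)
  interpret binomial_distribution m "1 / 2" by unfold_locales simp
  let ?tail = "{j. t / 2 \<le> \<bar>real j - real m * (1 / 2)\<bar>}"
  let ?T = "S \<inter> U"
  have imbalanced_iff: "t \<le> \<bar>imbalance U A S\<bar> \<longleftrightarrow> card (?T \<inter> A) \<in> ?tail" if "A \<subseteq> U" for A
  proof -
    have "?T \<inter> A = S \<inter> A" using that by auto
    then show ?thesis
      using imbalance_eq[OF assms(1) that, of S] by (auto simp: m_def abs_if field_simps)
  qed
  have "real (card {A \<in> Pow U. t \<le> \<bar>imbalance U A S\<bar>}) / 2 ^ card U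
      = measure_pmf.prob (pmf_of_set (Pow U)) {A. card (?T \<inter> A) \<in> ?tail}"
    using assms imbalanced_iff
    by (subst measure_pmf_of_set) (auto simp: card_Pow intro!: arg_cong[of _ _ card])
  also have "\<dots> = measure_pmf.prob (binomial_pmf m (1 / 2)) ?tail"
    by (simp add: map_pmf_card_Int_Pow[OF assms(1), of ?T, symmetric] m_def vimage_def)
  also have "\<dots> \<le> 2 * exp (- 2 * (t / 2)\<^sup>2 / m)"
    using m assms by (intro prob_abs_ge) auto
  also have "\<dots> \<le> 2 * exp (- t\<^sup>2 / (2 * card U))"
    using m by (simp add: power_divide field_simps mult_right_mono)
  finally show ?thesis by (simp add: field_simps)
qed

lemma two_power_card_le_card_halves:
  assumes "finite U" "U \<noteq> {}" "even (card U)"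
  shows "2 ^ card U \<le> real (card U) * real (card (halves U))"
proof -
  from assms(3) obtain k where k: "card U = 2 * k" by (elim evenE)
  then have "0 < k" using assms by (cases k) auto
  have "halves U = {H. H \<subseteq> U \<and> card H = k}" by (auto simp: halves_def k)
  then have "card (halves U) = 2 * k choose k" using n_subsets[OF assms(1)] k by simp
  then show ?thesis
    using central_binomial_lower_bound[OF \<open>0 < k\<close>] \<open>0 < k\<close> power_mult[of "2 :: real" 2 k]
    by (simp add: k field_simps)
qed

text \<open>Hoeffding's bound, times a factor \<open>u\<close> for passing from all subsets of a set of size \<open>u\<close>
  to its halves.\<close>

definition imbalance_rate :: "real \<Rightarrow> nat \<Rightarrow> real" where
  "imbalance_rate \<delta> u = 2 * u * exp (- \<delta>\<^sup>2 * u / 8)"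

lemma card_imbalanced_halves_le:
  assumes "finite U" "U \<noteq> {}" "even (card U)" "0 < \<delta>"
  shows "real (card {H \<in> halves U. \<delta> * (card U / 2) \<le> \<bar>imbalance U H S\<bar>})
       \<le> imbalance_rate \<delta> (card U) * card (halves U)"
proof -
  define t where "t = \<delta> * (card U / 2)"
  have "0 < t" using assms by (simp add: t_def card_gt_0_iff)
  have "real (card {H \<in> halves U. t \<le> \<bar>imbalance U H S\<bar>})
      \<le> real (card {H \<in> Pow U. t \<le> \<bar>imbalance U H S\<bar>})"
    using assms(1) by (intro of_nat_mono card_mono) (auto simp: halves_def)
  also have "\<dots> \<le> 2 * exp (- t\<^sup>2 / (2 * card U)) * 2 ^ card U"
    by (rule card_imbalanced_subsets_le[OF assms(1) \<open>0 < t\<close>])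
  also have "\<dots> \<le> 2 * exp (- t\<^sup>2 / (2 * card U)) * (card U * card (halves U))"
    using two_power_card_le_card_halves[OF assms(1-3)] by (intro mult_left_mono) auto
  also have "- t\<^sup>2 / (2 * card U) = - \<delta>\<^sup>2 * card U / 8"
    by (simp add: t_def power2_eq_square field_simps)
  finally show ?thesis by (simp add: imbalance_rate_def t_def mult_ac)
qed

subsection \<open>Fooling a value oracle algorithm\<close>

lemma card_ex_in_set_list_le:
  fixes c :: real
  assumes "finite I" and "\<And>x. real (card {a \<in> I. P a x}) \<le> c"
  shows "real (card {a \<in> I. \<exists>x\<in>set xs. P a x}) \<le> c * length xs"
proof -
  have "0 \<le> c" using assms(2) by (rule order_trans[OF of_nat_0_le_iff])
  have "{a \<in> I. \<exists>x\<in>set xs. P a x} = (\<Union>x\<in>set xs. {a \<in> I. P a x})" by auto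
  then have "real (card {a \<in> I. \<exists>x\<in>set xs. P a x}) \<le> (\<Sum>x\<in>set xs. real (card {a \<in> I. P a x}))"
    using card_UN_le[of "set xs" "\<lambda>x. {a \<in> I. P a x}"] by (simp flip: of_nat_sum)
  also have "\<dots> \<le> real (card (set xs)) * c"
    using assms(2) by (intro sum_bounded_above) auto
  also have "\<dots> \<le> real (length xs) * c"
    using \<open>0 \<le> c\<close> by (intro mult_right_mono) (simp_all add: card_length)
  finally show ?thesis by (simp add: mult.commute)
qed

lemma exists_emeasure_le_average:
  assumes "finite I" "I \<noteq> {}" and sets: "\<And>a. a \<in> I \<Longrightarrow> E a \<in> sets M"
  obtains a where "a \<in> I"
    "of_nat (card I) * emeasure M (E a) \<le> (\<integral>\<^sup>+\<omega>. of_nat (card {a \<in> I. \<omega> \<in> E a}) \<partial>M)"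
proof -
  have "Min ((\<lambda>a. emeasure M (E a)) ` I) \<in> (\<lambda>a. emeasure M (E a)) ` I"
    using assms(1,2) by (intro Min_in) auto
  then obtain a where a: "a \<in> I" "emeasure M (E a) = Min ((\<lambda>a. emeasure M (E a)) ` I)"
    by auto
  have "of_nat (card I) * emeasure M (E a) \<le> (\<Sum>a\<in>I. emeasure M (E a))"
    using assms(1) by (intro sum_bounded_below) (simp add: a(2))
  also have "\<dots> = (\<integral>\<^sup>+\<omega>. (\<Sum>a\<in>I. indicator (E a) \<omega>) \<partial>M)"
    using sets by (simp add: nn_integral_sum)
  also have "\<dots> = (\<integral>\<^sup>+\<omega>. of_nat (card {a \<in> I. \<omega> \<in> E a}) \<partial>M)"
    using assms(1) by (simp add: indicator_def sum_of_bool_eq Int_def)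
  finally show ?thesis using that a(1) by blast
qed

definition inspected_sets :: "('a set \<Rightarrow> real) \<Rightarrow> 'a strategy \<Rightarrow> 'a set list" where
  "inspected_sets f s = result f s # queries f s"

lemma result_eq_if_agree_on_queries:
  "\<forall>S\<in>set (queries f s). g S = f S \<Longrightarrow> result g s = result f s"
  by (induction s) auto

lemma sets_exists_inspected:
  assumes "oracle_algorithm N M A" "sym_submod N f"
  shows "{\<omega> \<in> space M. \<exists>S\<in>set (inspected_sets f (A \<omega>)). P S} \<in> sets M"
proof -
  have queries: "(\<lambda>\<omega>. queries f (A \<omega>)) \<in> M \<rightarrow>\<^sub>M count_space UNIV"
    and result: "(\<lambda>\<omega>. result f (A \<omega>)) \<in> M \<rightarrow>\<^sub>M count_space UNIV"
    using assms by (auto simp: oracle_algorithm_def)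
  have [measurable]: "Measurable.pred M (\<lambda>\<omega>. P (result f (A \<omega>)))"
      "Measurable.pred M (\<lambda>\<omega>. \<exists>S\<in>set (queries f (A \<omega>)). P S)"
    using measurable_compose[OF result, of P]
      measurable_compose[OF queries, of "\<lambda>Ss. \<exists>S\<in>set Ss. P S"]
    by simp_all
  have "{\<omega> \<in> space M. P (result f (A \<omega>)) \<or> (\<exists>S\<in>set (queries f (A \<omega>)). P S)} \<in> sets M"
    by measurable
  then show ?thesis by (simp add: inspected_sets_def)
qed

lemma borel_measurable_length_queries:
  assumes "oracle_algorithm N M A" "sym_submod N f"
  shows "(\<lambda>\<omega>. of_nat (length (queries f (A \<omega>))) :: ennreal) \<in> borel_measurable M"
proof -
  have "(\<lambda>\<omega>. queries f (A \<omega>)) \<in> M \<rightarrow>\<^sub>M count_space UNIV"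
    using assms by (simp add: oracle_algorithm_def)
  then show ?thesis by (rule measurable_compose) simp
qed

lemma nn_integral_length_inspected:
  assumes "oracle_algorithm N M A" "sym_submod N f"
  shows "(\<integral>\<^sup>+\<omega>. of_nat (length (inspected_sets f (A \<omega>))) \<partial>M) = 1 + expected_queries M A f"
proof -
  interpret prob_space M using assms(1) by (simp add: oracle_algorithm_def)
  show ?thesis
    using borel_measurable_length_queries[OF assms]
    by (simp add: inspected_sets_def expected_queries_def nn_integral_add emeasure_space_1)
qed

lemma exists_rarely_distinguished:
  fixes g :: "'c \<Rightarrow> 'a set \<Rightarrow> real" and \<eta> :: real
  assumes alg: "oracle_algorithm N M A" "sym_submod N f"
    and I: "finite I" "I \<noteq> {}"
    and \<eta>: "0 \<le> \<eta>" and rare: "\<And>S. real (card {a \<in> I. g a S \<noteq> f S}) \<le> \<eta> * card I"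
  obtains a where "a \<in> I"
    "emeasure M {\<omega> \<in> space M. \<exists>S\<in>set (inspected_sets f (A \<omega>)). g a S \<noteq> f S}
       \<le> ennreal \<eta> * (1 + expected_queries M A f)"
proof -
  let ?len = "\<lambda>\<omega>. of_nat (length (inspected_sets f (A \<omega>))) :: ennreal"
  define E where "E a = {\<omega> \<in> space M. \<exists>S\<in>set (inspected_sets f (A \<omega>)). g a S \<noteq> f S}" for a
  obtain a where a: "a \<in> I"
    "of_nat (card I) * emeasure M (E a) \<le> (\<integral>\<^sup>+\<omega>. of_nat (card {a \<in> I. \<omega> \<in> E a}) \<partial>M)"
    using exists_emeasure_le_average[OF I, of E M] sets_exists_inspected[OF alg]
    by (auto simp: E_def)
  note a(2)
  also have "(\<integral>\<^sup>+\<omega>. of_nat (card {a \<in> I. \<omega> \<in> E a}) \<partial>M)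
      \<le> (\<integral>\<^sup>+\<omega>. ennreal (\<eta> * card I) * ?len \<omega> \<partial>M)"
  proof (rule nn_integral_mono)
    fix \<omega> assume "\<omega> \<in> space M"
    then have "real (card {a \<in> I. \<omega> \<in> E a}) \<le> \<eta> * card I * length (inspected_sets f (A \<omega>))"
      using card_ex_in_set_list_le[OF I(1), of "\<lambda>a S. g a S \<noteq> f S", OF rare] by (simp add: E_def)
    from ennreal_leI[OF this]
    show "of_nat (card {a \<in> I. \<omega> \<in> E a}) \<le> ennreal (\<eta> * card I) * ?len \<omega>"
      using \<eta> by (simp add: ennreal_mult ennreal_of_nat_eq_real_of_nat)
  qed
  also have "\<dots> = ennreal (\<eta> * card I) * (1 + expected_queries M A f)"
    using borel_measurable_length_queries[OF alg] nn_integral_length_inspected[OF alg]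
    by (subst nn_integral_cmult) (simp_all add: inspected_sets_def)
  also have "\<dots> = of_nat (card I) * (ennreal \<eta> * (1 + expected_queries M A f))"
    using \<eta> by (simp add: ennreal_mult ennreal_of_nat_eq_real_of_nat mult_ac)
  finally have "emeasure M (E a) \<le> ennreal \<eta> * (1 + expected_queries M A f)"
    using I by (subst (asm) ennreal_mult_le_mult_iff) (auto simp: card_eq_0_iff)
  then show ?thesis using that a(1) by (simp add: E_def)
qed

lemma exists_fooling_function:
  fixes g :: "'c \<Rightarrow> 'a set \<Rightarrow> real" and \<eta> :: real
  assumes alg: "oracle_algorithm N M A" "sym_submod N f"
    and I: "finite I" "I \<noteq> {}"
    and \<eta>: "0 \<le> \<eta>" and rare: "\<And>S. real (card {a \<in> I. g a S \<noteq> f S}) \<le> \<eta> * card I"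
    and bounds: "\<And>S. f S \<le> B" "\<And>a S. a \<in> I \<Longrightarrow> g a S \<le> B + C" "0 \<le> B" "0 \<le> C"
    and few_queries: "expected_queries M A f \<le> ennreal L" "0 \<le> L"
  obtains a where "a \<in> I" "(\<integral>\<omega>. g a (result (g a) (A \<omega>)) \<partial>M) \<le> B + C * (\<eta> * (1 + L))"
proof -
  interpret prob_space M using alg(1) by (simp add: oracle_algorithm_def)
  obtain a where a: "a \<in> I" and
    "emeasure M {\<omega> \<in> space M. \<exists>S\<in>set (inspected_sets f (A \<omega>)). g a S \<noteq> f S}
       \<le> ennreal \<eta> * (1 + expected_queries M A f)" (is "emeasure M ?E \<le> _")
    using exists_rarely_distinguished[OF alg I \<eta> rare] .
  note this(2)
  also have "ennreal \<eta> * (1 + expected_queries M A f) \<le> ennreal \<eta> * (1 + ennreal L)"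
    using few_queries by (intro mult_left_mono add_left_mono) auto
  also have "\<dots> = ennreal (\<eta> * (1 + L))"
    using few_queries \<eta> by (simp add: ennreal_mult)
  finally have prob_E: "prob ?E \<le> \<eta> * (1 + L)"
    using few_queries \<eta> by (simp add: emeasure_eq_measure)
  have [measurable]: "?E \<in> sets M" by (rule sets_exists_inspected[OF alg])
  have "(\<integral>\<omega>. g a (result (g a) (A \<omega>)) \<partial>M) \<le> (\<integral>\<omega>. B + C * indicator ?E \<omega> \<partial>M)"
  proof (rule integral_mono')
    fix \<omega> assume \<omega>: "\<omega> \<in> space M"
    show "g a (result (g a) (A \<omega>)) \<le> B + C * indicator ?E \<omega>"
    proof (cases "\<omega> \<in> ?E")
      case False
      then have "result (g a) (A \<omega>) = result f (A \<omega>)" "g a (result f (A \<omega>)) = f (result f (A \<omega>))"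
        using \<omega> by (auto simp: inspected_sets_def intro!: result_eq_if_agree_on_queries)
      then show ?thesis using False bounds(1) by simp
    qed (simp add: bounds a)
  qed (use bounds in \<open>auto simp: emeasure_eq_measure\<close>)
  also have "\<dots> = B + C * prob ?E"
    by (simp add: prob_space emeasure_eq_measure)
  also have "\<dots> \<le> B + C * (\<eta> * (1 + L))"
    using prob_E bounds by (intro add_left_mono mult_left_mono) auto
  finally show ?thesis using that a by blast
qed

lemma exists_fooling_hidden_cut:
  assumes alg: "oracle_algorithm N M A"
    and U: "finite U" "U \<subseteq> N" "U \<noteq> {}" "even (card U)" and "0 < \<delta>"
    and few_queries: "expected_queries M A (clique_cut U) \<le> ennreal L" "0 \<le> L"
  obtains H where "H \<in> halves U"
    "(\<integral>\<omega>. hidden_cut U H \<delta> (result (hidden_cut U H \<delta>) (A \<omega>)) \<partial>M)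
       \<le> (1 + imbalance_rate \<delta> (card U) * (1 + L)) * (real (card U) / 2)\<^sup>2"
proof -
  define B where "B = (real (card U) / 2)\<^sup>2"
  let ?\<eta> = "imbalance_rate \<delta> (card U)"
  have rate_nonneg: "0 \<le> ?\<eta>" by (simp add: imbalance_rate_def)
  have rare: "real (card {H \<in> halves U. hidden_cut U H \<delta> S \<noteq> clique_cut U S})
      \<le> ?\<eta> * card (halves U)" for S
  proof -
    have "\<delta> * (card U / 2) \<le> \<bar>imbalance U H S\<bar>" if "hidden_cut U H \<delta> S \<noteq> clique_cut U S" for H
      using that hidden_cut_eq_clique_cut by (meson linear)
    then have "real (card {H \<in> halves U. hidden_cut U H \<delta> S \<noteq> clique_cut U S})
        \<le> real (card {H \<in> halves U. \<delta> * (card U / 2) \<le> \<bar>imbalance U H S\<bar>})"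
      using finite_halves[OF U(1)] by (intro of_nat_mono card_mono) auto
    also have "\<dots> \<le> ?\<eta> * card (halves U)"
      by (rule card_imbalanced_halves_le[OF U(1,3,4) \<open>0 < \<delta>\<close>])
    finally show ?thesis .
  qed
  have nonempty: "halves U \<noteq> {}"
    using two_power_card_le_card_halves[OF U(1,3,4)] not_le[of "2 ^ card U" "0 :: real"] by auto
  have bounds: "clique_cut U S \<le> B" "H \<in> halves U \<Longrightarrow> hidden_cut U H \<delta> S \<le> B + B" "0 \<le> B" for H S
    using clique_cut_le[OF U(1), of S] hidden_cut_le[OF U(1), of H \<delta> S] \<open>0 < \<delta>\<close>
    by (simp_all add: B_def)
  obtain H where "H \<in> halves U"
    "(\<integral>\<omega>. hidden_cut U H \<delta> (result (hidden_cut U H \<delta>) (A \<omega>)) \<partial>M) \<le> B + B * (?\<eta> * (1 + L))"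
    using exists_fooling_function[OF alg sym_submod_clique_cut[OF U(1,2)] finite_halves[OF U(1)]
        nonempty rate_nonneg rare bounds(1,2,3,3) few_queries] .
  then show ?thesis using that by (simp add: B_def algebra_simps)
qed

lemma expected_queries_clique_cut_gt:
  assumes N: "finite N" "\<F> \<subseteq> Pow N"
    and alg: "oracle_algorithm N M A" "achieves_ratio \<alpha> N \<F> M A" "0 \<le> \<alpha>"
    and U: "U \<subseteq> N" "U \<noteq> {}" "even (card U)"
    and feasible: "\<And>H. H \<in> halves U \<Longrightarrow> \<exists>S\<in>\<F>. S \<inter> U = H"
    and \<delta>: "0 < \<delta>" "\<delta> \<le> 1" and "0 \<le> L"
    and gap: "1 + imbalance_rate \<delta> (card U) * (1 + L) < \<alpha> * (1 + (1 - \<delta>)\<^sup>2)"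
  shows "ennreal L < expected_queries M A (clique_cut U)"
proof (rule ccontr)
  assume "\<not> ?thesis"
  then have few_queries: "expected_queries M A (clique_cut U) \<le> ennreal L" by simp
  have finU: "finite U" using finite_subset[OF U(1) N(1)] .
  define B where "B = (real (card U) / 2)\<^sup>2"
  have "0 < B" using U finU by (simp add: B_def card_gt_0_iff)
  obtain H where H: "H \<in> halves U" and
    output_le: "(\<integral>\<omega>. hidden_cut U H \<delta> (result (hidden_cut U H \<delta>) (A \<omega>)) \<partial>M)
      \<le> (1 + imbalance_rate \<delta> (card U) * (1 + L)) * B"
    using exists_fooling_hidden_cut[OF alg(1) finU U \<delta>(1) few_queries \<open>0 \<le> L\<close>] unfolding B_def .
  obtain S where S: "S \<in> \<F>" "H = S \<inter> U" using feasible[OF H] by blast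
  have "(1 + (1 - \<delta>)\<^sup>2) * B = hidden_cut U H \<delta> S"
    using hidden_cut_at_half[of U S \<delta>] finU H \<delta>(2) by (simp add: S(2) B_def)
  also have "\<dots> \<le> Max (hidden_cut U H \<delta> ` \<F>)"
    using S(1) N finite_subset[OF N(2)] by (intro Max_ge) auto
  finally have "\<alpha> * ((1 + (1 - \<delta>)\<^sup>2) * B) \<le> \<alpha> * Max (hidden_cut U H \<delta> ` \<F>)"
    using alg(3) by (rule mult_left_mono)
  also have "\<dots> \<le> (\<integral>\<omega>. hidden_cut U H \<delta> (result (hidden_cut U H \<delta>) (A \<omega>)) \<partial>M)"
    using alg(2) sym_submod_hidden_cut[OF finU U(1) H, of \<delta>] \<delta>(1) by (simp add: achieves_ratio_def)
  also note output_le
  finally have "\<alpha> * (1 + (1 - \<delta>)\<^sup>2) \<le> 1 + imbalance_rate \<delta> (card U) * (1 + L)"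
    using \<open>0 < B\<close> by (simp add: mult.assoc[symmetric])
  with gap show False by simp
qed

subsection \<open>Cardinality constraints\<close>

lemma exists_subset_with_trace:
  assumes "finite N" "U \<subseteq> N" "H \<subseteq> U" "card H \<le> s" "s + card U \<le> card N + card H"
  obtains S where "S \<subseteq> N" "card S = s" "S \<inter> U = H"
proof -
  have fin: "finite U" "finite H"
    using assms finite_subset[of U N] finite_subset[of H U] by auto
  have "s - card H \<le> card (N - U)" using assms fin by (simp add: card_Diff_subset)
  then obtain W where W: "W \<subseteq> N - U" "card W = s - card H" "finite W"
    using obtain_subset_with_card_n by metis
  then have "card (H \<union> W) = s" using assms fin by (subst card_Un_disjoint) auto
  then show ?thesis using that[of "H \<union> W"] assms W by auto
qed

lemma exists_subset_with_feasible_halves: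
  assumes "finite N" "q dvd card N" "0 < p" "p < q"
  obtains U where "U \<subseteq> N" "even (card U)" "2 * card N \<le> q * card U"
    "\<And>H. H \<in> halves U \<Longrightarrow> \<exists>S\<in>card_eq_family p q N. S \<inter> U = H"
proof -
  obtain r where r: "card N = q * r" using assms(2) by (elim dvdE)
  define k where "k = min p (q - p) * r"
  have "1 \<le> min p (q - p)" "min p (q - p) \<le> p" "p + min p (q - p) \<le> q" using assms by auto
  from this[THEN mult_le_mono1, of r]
  have k: "r \<le> k" "k \<le> p * r" "p * r + k \<le> card N"
    by (simp_all add: k_def r distrib_right)
  obtain U where U: "U \<subseteq> N" "card U = 2 * k"
    using obtain_subset_with_card_n[of "2 * k" N] k(2,3) by force
  have feasible: "\<exists>S\<in>card_eq_family p q N. S \<inter> U = H" if "H \<in> halves U" for H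
  proof -
    have H: "H \<subseteq> U" "card H = k" using that U(2) by (simp_all add: halves_def)
    obtain S where "S \<subseteq> N" "card S = p * r" "S \<inter> U = H"
      using exists_subset_with_trace[OF assms(1) U(1) H(1), of "p * r"] H(2) U(2) k by auto
    then show ?thesis
      using assms by (intro bexI[of _ S]) (auto simp: card_eq_family_def r)
  qed
  have "2 * card N \<le> q * card U" using k(1) by (simp add: U r)
  then show ?thesis using that[OF U(1) _ _ feasible] U(2) by simp
qed

lemma exists_sym_submod_many_queries:
  fixes L :: real
  assumes pq: "0 < p" "p < q" and N: "finite N" "N \<noteq> {}" "q dvd card N"
    and \<F>: "card_eq_family p q N \<subseteq> \<F>" "\<F> \<subseteq> Pow N"
    and alg: "oracle_algorithm N M A" "achieves_ratio \<alpha> N \<F> M A" "0 \<le> \<alpha>"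
    and \<delta>: "0 < \<delta>" "\<delta> \<le> 1" and "0 \<le> L"
    and gap: "\<And>u. 2 * card N \<le> q * u \<Longrightarrow> u \<le> card N \<Longrightarrow>
      1 + imbalance_rate \<delta> u * (1 + L) < \<alpha> * (1 + (1 - \<delta>)\<^sup>2)"
  shows "\<exists>f. sym_submod N f \<and> ennreal L \<le> expected_queries M A f"
proof -
  obtain U where U: "U \<subseteq> N" "even (card U)" "2 * card N \<le> q * card U"
    and feasible: "\<And>H. H \<in> halves U \<Longrightarrow> \<exists>S\<in>card_eq_family p q N. S \<inter> U = H"
    using exists_subset_with_feasible_halves[OF N(1,3) pq] by blast
  have "U \<noteq> {}" using U(3) N by auto
  have "1 + imbalance_rate \<delta> (card U) * (1 + L) < \<alpha> * (1 + (1 - \<delta>)\<^sup>2)"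
    using U N(1) by (intro gap card_mono)
  then have "ennreal L < expected_queries M A (clique_cut U)"
    using expected_queries_clique_cut_gt[OF N(1) \<F>(2) alg U(1) \<open>U \<noteq> {}\<close> U(2) _ \<delta> \<open>0 \<le> L\<close>]
      feasible \<F>(1) by blast
  then show ?thesis
    using sym_submod_clique_cut[OF finite_subset[OF U(1) N(1)] U(1)] less_imp_le by blast
qed

lemma eventually_ratio_gap:
  fixes q :: nat and \<delta> \<epsilon> :: real
  assumes "0 < q" "0 < \<delta>" "\<delta> \<le> 1 / 2" "2 * \<delta> \<le> \<epsilon>"
  defines "c \<equiv> \<delta>\<^sup>2 / (8 * q)"
  shows "\<forall>\<^sub>F n in sequentially. \<forall>u. 2 * n \<le> q * u \<longrightarrow> u \<le> n \<longrightarrow>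
    1 + imbalance_rate \<delta> u * (1 + exp (c * n)) < (1 / 2 + \<epsilon>) * (1 + (1 - \<delta>)\<^sup>2)"
proof -
  have "0 < \<epsilon>" "0 < c" using assms by (simp_all add: c_def)
  have value_gap: "1 + \<epsilon> / 2 \<le> (1 / 2 + \<epsilon>) * (1 + (1 - \<delta>)\<^sup>2)"
  proof -
    have "\<epsilon> * \<delta> \<le> \<epsilon> * (1 / 2)" using assms \<open>0 < \<epsilon>\<close> by (intro mult_left_mono) auto
    moreover have "(1 / 2 + \<epsilon>) * (2 - 2 * \<delta>) = 1 + 2 * \<epsilon> - \<delta> - 2 * (\<epsilon> * \<delta>)"
      by (simp add: algebra_simps)
    moreover have "(1 / 2 + \<epsilon>) * (2 - 2 * \<delta>) \<le> (1 / 2 + \<epsilon>) * (1 + (1 - \<delta>)\<^sup>2)"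
      using \<open>0 < \<epsilon>\<close> by (intro mult_left_mono) (auto simp: power2_eq_square algebra_simps)
    ultimately show ?thesis using assms(4) by linarith
  qed
  have "((\<lambda>n :: nat. 2 * real n * exp (- 2 * c * n) * (1 + exp (c * n))) \<longlongrightarrow> 0) sequentially"
    using \<open>0 < c\<close> by real_asymp
  then have "\<forall>\<^sub>F n :: nat in sequentially.
      2 * real n * exp (- 2 * c * n) * (1 + exp (c * n)) < \<epsilon> / 2"
    by (rule order_tendstoD) (use \<open>0 < \<epsilon>\<close> in simp)
  then show ?thesis
  proof (rule eventually_mono, intro allI impI)
    fix n u :: nat
    assume small: "2 * real n * exp (- 2 * c * n) * (1 + exp (c * n)) < \<epsilon> / 2"
      and u: "2 * n \<le> q * u" "u \<le> n"
    have "real (2 * n) \<le> real (q * u)" using u(1) by (rule of_nat_mono)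
    then have "c * (2 * n) \<le> c * (q * u)" using \<open>0 < c\<close> by (intro mult_left_mono) auto
    also have "\<dots> = \<delta>\<^sup>2 * u / 8" using assms(1) by (simp add: c_def)
    finally have "imbalance_rate \<delta> u * (1 + exp (c * n))
        \<le> 2 * real n * exp (- 2 * c * n) * (1 + exp (c * n))"
      unfolding imbalance_rate_def using u(2) by (intro mult_mono) (auto intro: add_nonneg_nonneg)
    then show "1 + imbalance_rate \<delta> u * (1 + exp (c * n)) < (1 / 2 + \<epsilon>) * (1 + (1 - \<delta>)\<^sup>2)"
      using small value_gap by linarith
  qed
qed

theorem theorem1p4:
  fixes p q :: nat and \<epsilon> :: real
  assumes "0 < p" and "p < q" and "0 < \<epsilon>"
  shows "\<exists>c>0. \<exists>n0::nat. \<forall>(N :: 'a set) (M :: 'w measure) (A :: 'w \<Rightarrow> 'a strategy).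
           finite N \<longrightarrow> card N \<ge> n0 \<longrightarrow> q dvd card N \<longrightarrow> oracle_algorithm N M A \<longrightarrow>
           achieves_ratio (1/2 + \<epsilon>) N (card_eq_family p q N) M A \<or>
           achieves_ratio (1/2 + \<epsilon>) N (card_le_family p q N) M A \<longrightarrow>
           (\<exists>f. sym_submod N f \<and>
                expected_queries M A f \<ge> ennreal (exp (c * real (card N))))"
proof -
  define \<delta> where "\<delta> = min (1 / 2) (\<epsilon> / 2)"
  have \<delta>: "0 < \<delta>" "\<delta> \<le> 1 / 2" "2 * \<delta> \<le> \<epsilon>" using assms(3) by (auto simp: \<delta>_def)
  define c where "c = \<delta>\<^sup>2 / (8 * q)"
  obtain n1 where gap:
    "1 + imbalance_rate \<delta> u * (1 + exp (c * n)) < (1 / 2 + \<epsilon>) * (1 + (1 - \<delta>)\<^sup>2)"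
    if "n1 \<le> n" "2 * n \<le> q * u" "u \<le> n" for n u
    using eventually_ratio_gap[of q \<delta> \<epsilon>] assms \<delta> unfolding eventually_sequentially c_def by auto
  have lower_bound: "\<exists>f. sym_submod N f \<and> expected_queries M A f \<ge> ennreal (exp (c * card N))"
    if "finite N" "max 1 n1 \<le> card N" "q dvd card N" "oracle_algorithm N M A"
      "card_eq_family p q N \<subseteq> \<F>" "\<F> \<subseteq> Pow N" "achieves_ratio (1 / 2 + \<epsilon>) N \<F> M A"
    for N :: "'a set" and M :: "'w measure" and A \<F>
    using that assms \<delta> gap by (intro exists_sym_submod_many_queries[where \<F> = \<F> and \<delta> = \<delta>]) auto
  have families: "card_eq_family p q N \<subseteq> Pow N" "card_eq_family p q N \<subseteq> card_le_family p q N"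
    "card_le_family p q N \<subseteq> Pow N" for N :: "'a set"
    by (auto simp: card_eq_family_def card_le_family_def)
  have "0 < c" using assms \<delta> by (simp add: c_def)
  then show ?thesis
    using lower_bound[OF _ _ _ _ subset_refl families(1)] lower_bound[OF _ _ _ _ families(2,3)]
    by (intro exI[of _ c] conjI exI[of _ "max 1 n1"] allI impI) (assumption, elim disjE)
qed

end
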